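(* Let $z_n^i=[u_n^i,\phi_n^i,w_n^i,v_n^i]^\top$, $N$-periodic in $n$, satisfy the Euler box scheme for the Benjamin equation $$M\delta_t z_n^i+K\delta_x z_n^i=\frac{\delta\mathcal S}{\delta z}(z_n^i),\qquad \frac{\delta\mathcal S}{\delta z}(z_n^i)=\begin{bmatrix}-w_n^i-\gamma u_n^i-\frac{\lambda}{2}(u_n^i)^2+\alpha (L_{\Delta x}\boldsymbol u^i)_n\\ 0\\ -u_n^i\\ \beta v_n^i\end{bmatrix}.$$ Define the two-forms $$\omega_n^i=\tfrac12\, \mathrm d z_n^{i-1}\wedge M\,\mathrm d z_n^i,\qquad \kappa_n^i=\tfrac12\,\mathrm d z_{n-1}^i\wedge K\,\mathrm d z_n^i .$$ Then $$\delta_t^+\omega_n^i+\delta_x^+\kappa_n^i=\alpha\,\mathrm d u_n^i\wedge (L_{\Delta x}\,\mathrm d\boldsymbol u^i)_n$$ and $$\delta_t^+\sum_{n=0}^{N-1}\omega_n^i=0 .$$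
   Context: Real parameters $\alpha,\beta,\gamma,\lambda$; period $l>0$; number of grid points $N$; $\Delta x=l/N$; time step $\Delta t>0$; $u_n^i\approx u(i\Delta t,n\Delta x)$. The periodic boundary condition is imposed: all grid functions are $N$-periodic in $n$. $X_{\mathrm d}$ is the space of sequences $\boldsymbol u=\{u_n\}_{n\in\mathbb Z}$ with $u_{n+N}=u_n$; $\boldsymbol u^i=\{u_n^i\}_{n\in\mathbb Z}\in X_{\mathrm d}$. Difference operators: $\delta_x^+u_n=(u_{n+1}-u_n)/\Delta x$, $\delta_x u_n=(u_{n+1}-u_{n-1})/(2\Delta x)$, $\delta_t^+u^i=(u^{i+1}-u^i)/\Delta t$, $\delta_t u^i=(u^{i+1}-u^{i-1})/(2\Delta t)$. Matrices: $$M=\begin{bmatrix}0&\frac12&0&0\\-\frac12&0&0&0\\0&0&0&0\\0&0&0&0\end{bmatrix},\qquad K=\begin{bmatrix}0&0&0&-\beta\\0&0&1&0\\0&-1&0&0\\ \beta&0&0&0\end{bmatrix}.$$ Discrete Fourier transform: $(F_{\Delta x}\boldsymbol u)_k=\sum_{n=0}^{N-1}u_n\mathrm e^{-2\pi \mathrm i nk/N}$, with inverse $(F_{\Delta x}^{-1}\boldsymbol v)_n=\frac1N\sum_{k=0}^{N-1}v_k\mathrm e^{2\pi \mathrm i nk/N}$. The operator $L_{\Delta x}$ (discretization of $L=H\partial_x$, $H$ the Hilbert transform) is $L_{\Delta x}\boldsymbol u=F_{\Delta x}^{-1}\left(\frac{2\pi}{l}\tilde K S\right)F_{\Delta x}\boldsymbol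 u$, where the diagonal matrices act on the components $k=0,\dots,N-1$ and - if $N$ is even: $\tilde K=\mathrm{diag}(0,1,\dots,\frac N2-1,0,-(\frac N2-1),\dots,-1)$ and $S=\mathrm{diag}(0,1,\dots,1,0,-1,\dots,-1)$ with $\frac N2-1$ entries $1$ and $\frac N2-1$ entries $-1$; - if $N$ is odd: $\tilde K=\mathrm{diag}(0,1,\dots,\frac{N-1}2,-\frac{N-1}2,\dots,-1)$ and $S=\mathrm{diag}(0,1,\dots,1,-1,\dots,-1)$ with $\frac{N-1}2$ entries $1$ and $\frac{N-1}2$ entries $-1$. Differentials: $\mathrm d z_n^i$ denotes the vector of differential one-forms of $z_n^i$ (differentiating with respect to the parameters/initial data of a smooth family of numerical solutions, $N$-periodic in $n$); these satisfy the discrete variational equation $M\delta_t\,\mathrm dz_n^i+K\delta_x\,\mathrm dz_n^i=\mathrm d\left(\frac{\delta\mathcal S}{\delta z}(z_n^i)\right)$. Real matrices act linearly on vectors of one-forms, $(L_{\Delta x}\,\mathrm d\boldsymbol u^i)_n$ is $L_{\Delta x}$ applied to $\{\mathrm d u_n^i\}_n$, and for vectors of one-forms $a\wedge b=\sum_k a_k\wedge b_k$. *)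

theory Defs
  imports "HOL-Analysis.Analysis"
begin

section \<open>Difference operators\<close>

text \<open>The argument \<open>h\<close> is the step size (\<open>\<Delta>t\<close> or \<open>\<Delta>x\<close>); time and space
  indices are integers, so that \<open>k - 1\<close> is never truncated.\<close>

definition fwd_diff :: "real \<Rightarrow> (int \<Rightarrow> 'a::real_vector) \<Rightarrow> int \<Rightarrow> 'a" where
  "fwd_diff h f k = (f (k + 1) - f k) /\<^sub>R h"

definition ctr_diff :: "real \<Rightarrow> (int \<Rightarrow> 'a::real_vector) \<Rightarrow> int \<Rightarrow> 'a" where
  "ctr_diff h f k = (f (k + 1) - f (k - 1)) /\<^sub>R (2 * h)"


section \<open>The discrete operator obtained from \<open>H \<partial>\<^sub>x\<close>\<close>

definition dft :: "nat \<Rightarrow> (int \<Rightarrow> complex) \<Rightarrow> nat \<Rightarrow> complex" where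
  "dft N u k = (\<Sum>n<N. u (int n) * exp (- 2 * of_real pi * \<i> * of_nat n * of_nat k / of_nat N))"

definition inv_dft :: "nat \<Rightarrow> (nat \<Rightarrow> complex) \<Rightarrow> int \<Rightarrow> complex" where
  "inv_dft N v n =
     (1 / of_nat N) * (\<Sum>k<N. v k * exp (2 * of_real pi * \<i> * of_int n * of_nat k / of_nat N))"

text \<open>Diagonal entries, at positions \<open>k = 0, \<dots>, N - 1\<close>, of the matrices \<open>K~\<close> and \<open>S\<close>.\<close>

definition K_tilde :: "nat \<Rightarrow> nat \<Rightarrow> int" where
  "K_tilde N k =
     (if even N then
        (if k < N div 2 then int k else if k = N div 2 then 0 else int k - int N)
      else
        (if k \<le> (N - 1) div 2 then int k else int k - int N))"

definition S_sign :: "nat \<Rightarrow> nat \<Rightarrow> int" where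
  "S_sign N k =
     (if k = 0 then 0
      else if even N then
        (if k < N div 2 then 1 else if k = N div 2 then 0 else - 1)
      else
        (if k \<le> (N - 1) div 2 then 1 else - 1))"

definition L_cplx :: "nat \<Rightarrow> real \<Rightarrow> (int \<Rightarrow> complex) \<Rightarrow> int \<Rightarrow> complex" where
  "L_cplx N l u =
     inv_dft N (\<lambda>k. of_real (2 * pi / l) * of_int (K_tilde N k) * of_int (S_sign N k) * dft N u k)"

text \<open>The operator on real sequences. Taking the real part discards nothing, see
  \<open>of_real_L_op\<close> below.\<close>

definition L_op :: "nat \<Rightarrow> real \<Rightarrow> (int \<Rightarrow> real) \<Rightarrow> int \<Rightarrow> real" where
  "L_op N l u n = Re (L_cplx N l (\<lambda>m. of_real (u m)) n)"

lemma symbol_reflect: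
  assumes "0 < k" "k < N"
  shows "K_tilde N (N - k) * S_sign N (N - k) = K_tilde N k * S_sign N k"
proof (cases "even N")
  case True
  then obtain m where "N = 2 * m" by blast
  with assms show ?thesis by (auto simp: K_tilde_def S_sign_def)
next
  case False
  then obtain m where "N = 2 * m + 1" by (blast elim: oddE)
  with assms show ?thesis by (auto simp: K_tilde_def S_sign_def)
qed

lemma exp_reflect:
  fixes n :: int
  assumes "k < N"
  shows "exp (2 * of_real pi * \<i> * of_int n * of_nat (N - k) / of_nat N) =
         exp (- 2 * of_real pi * \<i> * of_int n * of_nat k / of_nat N)"
proof -
  have "2 * of_real pi * \<i> * of_int n * of_nat (N - k) / of_nat N =
        - 2 * of_real pi * \<i> * of_int n * of_nat k / of_nat N + (of_int (2 * n) * of_real pi) * \<i>"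
    using assms by (simp add: of_nat_diff field_simps)
  then show ?thesis
    by (simp only: exp_add exp_integer_2pi[OF Ints_of_int, of n] exp_plus_2pin of_int_mult)
       (simp add: mult_ac exp_integer_2pi)
qed

lemma dft_reflect:
  assumes "k < N"
  shows "dft N (\<lambda>m. of_real (u m)) (N - k) = cnj (dft N (\<lambda>m. of_real (u m)) k)"
  unfolding dft_def cnj_sum
proof (rule sum.cong[OF refl])
  fix m
  show "of_real (u (int m)) * exp (- 2 * of_real pi * \<i> * of_nat m * of_nat (N - k) / of_nat N) =
        cnj (of_real (u (int m)) * exp (- 2 * of_real pi * \<i> * of_nat m * of_nat k / of_nat N))"
    using exp_reflect[OF assms, of "- int m"] by (simp add: exp_cnj)
qed

lemma of_real_L_op: "of_real (L_op N l u n) = L_cplx N l (\<lambda>m. of_real (u m)) n"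
proof -
  define t where "t k = of_real (2 * pi / l) * of_int (K_tilde N k) * of_int (S_sign N k)
      * dft N (\<lambda>m. of_real (u m)) k * exp (2 * of_real pi * \<i> * of_int n * of_nat k / of_nat N)" for k
  have t0: "t 0 = 0"
    by (simp add: t_def S_sign_def)
  have refl: "t (N - k) = cnj (t k)" if "0 < k" "k < N" for k
  proof -
    have "exp (2 * of_real pi * \<i> * of_int n * of_nat (N - k) / of_nat N) =
          cnj (exp (2 * of_real pi * \<i> * of_int n * of_nat k / of_nat N))"
      using exp_reflect[OF that(2), of n] by (simp add: exp_cnj)
    moreover have "of_int (K_tilde N (N - k)) * of_int (S_sign N (N - k)) =
        (of_int (K_tilde N k) * of_int (S_sign N k) :: complex)"
      using symbol_reflect[OF that] by (metis of_int_mult)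
    ultimately show ?thesis
      by (simp add: t_def dft_reflect[OF that(2)] mult.assoc)
  qed
  have drop: "(\<Sum>k<N. t k) = (\<Sum>k\<in>{0<..<N}. t k)"
    by (rule sum.mono_neutral_right) (use t0 in auto)
  have "cnj (\<Sum>k\<in>{0<..<N}. t k) = (\<Sum>k\<in>{0<..<N}. t k)"
    unfolding cnj_sum
    by (rule sum.reindex_bij_witness[of _ "\<lambda>k. N - k" "\<lambda>k. N - k"]) (auto simp: refl)
  moreover have "L_cplx N l (\<lambda>m. of_real (u m)) n = (1 / of_nat N) * (\<Sum>k\<in>{0<..<N}. t k)"
    unfolding L_cplx_def inv_dft_def drop[symmetric] by (simp only: t_def[abs_def])
  ultimately have "cnj (L_cplx N l (\<lambda>m. of_real (u m)) n) = L_cplx N l (\<lambda>m. of_real (u m)) n"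
    by simp
  then show ?thesis
    unfolding L_op_def by (metis Reals_cnj_iff of_real_Re)
qed


section \<open>The Euler box scheme\<close>

lemma vector_4:
  fixes a b c d :: "'a::zero"
  shows "(vector [a, b, c, d] :: 'a^4) $ 1 = a"
    and "(vector [a, b, c, d] :: 'a^4) $ 2 = b"
    and "(vector [a, b, c, d] :: 'a^4) $ 3 = c"
    and "(vector [a, b, c, d] :: 'a^4) $ 4 = d"
  unfolding vector_def by simp_all

definition M_mat :: "real^4^4" where
  "M_mat = vector [vector [0, 1/2, 0, 0],
                   vector [- 1/2, 0, 0, 0],
                   vector [0, 0, 0, 0],
                   vector [0, 0, 0, 0]]"

definition K_mat :: "real \<Rightarrow> real^4^4" where
  "K_mat \<beta> = vector [vector [0, 0, 0, - \<beta>],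
                     vector [0, 0, 1, 0],
                     vector [0, - 1, 0, 0],
                     vector [\<beta>, 0, 0, 0]]"

text \<open>A grid vector is \<open>z = (u, \<phi>, w, v)\<close>, so that \<open>u\<close>, \<open>w\<close>, \<open>v\<close> are the components
  1, 3, 4. The argument \<open>z\<close> of \<open>grad_S\<close> is the whole time level, because \<open>L_op\<close> is nonlocal.\<close>

definition grad_S ::
  "real \<Rightarrow> real \<Rightarrow> real \<Rightarrow> real \<Rightarrow> nat \<Rightarrow> real \<Rightarrow> (int \<Rightarrow> real^4) \<Rightarrow> int \<Rightarrow> real^4" where
  "grad_S \<alpha> \<beta> \<gamma> lam N l z n =
     vector [- (z n $ 3) - \<gamma> * (z n $ 1) - lam / 2 * (z n $ 1)\<^sup>2 + \<alpha> * L_op N l (\<lambda>m. z m $ 1) n,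
             0,
             - (z n $ 1),
             \<beta> * (z n $ 4)]"

text \<open>The scheme at time level \<open>i\<close> and grid point \<open>n\<close>, with \<open>z i n\<close> standing for \<open>z\<^sub>n\<^sup>i\<close>.\<close>

definition euler_box ::
  "real \<Rightarrow> real \<Rightarrow> real \<Rightarrow> real \<Rightarrow> nat \<Rightarrow> real \<Rightarrow> real \<Rightarrow> (int \<Rightarrow> int \<Rightarrow> real^4) \<Rightarrow> int \<Rightarrow> int \<Rightarrow> bool"
  where
  "euler_box \<alpha> \<beta> \<gamma> lam N l dt z i n \<longleftrightarrow>
     M_mat *v ctr_diff dt (\<lambda>j. z j n) i + K_mat \<beta> *v ctr_diff (l / real N) (z i) n
       = grad_S \<alpha> \<beta> \<gamma> lam N l (z i) n"


section \<open>Differential forms on the parameter space\<close>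

text \<open>Forms live on the space \<open>'p\<close> of parameters (initial data) of the family of solutions.
  A (vector-valued) one-form takes a point and a tangent vector, a two-form takes a point and two
  tangent vectors. The wedge product is normalised as
  \<open>(a \<and> b)(\<xi>, \<eta>) = a(\<xi>) b(\<eta>) - a(\<eta>) b(\<xi>)\<close>.\<close>

type_synonym ('p, 'a) one_form = "'p \<Rightarrow> 'p \<Rightarrow> 'a"
type_synonym 'p two_form = "'p \<Rightarrow> 'p \<Rightarrow> 'p \<Rightarrow> real"

definition ext_d :: "('p::euclidean_space \<Rightarrow> 'a::real_normed_vector) \<Rightarrow> ('p, 'a) one_form" where
  "ext_d f p \<xi> = frechet_derivative f (at p) \<xi>"

definition wedge :: "('p, real) one_form \<Rightarrow> ('p, real) one_form \<Rightarrow> 'p two_form" where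
  "wedge a b p \<xi> \<eta> = a p \<xi> * b p \<eta> - a p \<eta> * b p \<xi>"

definition vwedge :: "('p, real^4) one_form \<Rightarrow> ('p, real^4) one_form \<Rightarrow> 'p two_form" where
  "vwedge a b p \<xi> \<eta> = (\<Sum>k\<in>UNIV. wedge (\<lambda>q \<zeta>. a q \<zeta> $ k) (\<lambda>q \<zeta>. b q \<zeta> $ k) p \<xi> \<eta>)"

definition mat_form :: "real^4^4 \<Rightarrow> ('p, real^4) one_form \<Rightarrow> ('p, real^4) one_form" where
  "mat_form A a p \<xi> = A *v a p \<xi>"

definition L_form :: "nat \<Rightarrow> real \<Rightarrow> (int \<Rightarrow> ('p, real) one_form) \<Rightarrow> int \<Rightarrow> ('p, real) one_form" where
  "L_form N l a n p \<xi> = L_op N l (\<lambda>m. a m p \<xi>) n"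

text \<open>A family of grid functions is given as \<open>z i n p\<close> with \<open>p\<close> the parameter.\<close>

definition omega ::
  "(int \<Rightarrow> int \<Rightarrow> 'p::euclidean_space \<Rightarrow> real^4) \<Rightarrow> int \<Rightarrow> int \<Rightarrow> 'p two_form" where
  "omega z i n p \<xi> \<eta> =
     1 / 2 * vwedge (ext_d (z (i - 1) n)) (mat_form M_mat (ext_d (z i n))) p \<xi> \<eta>"

definition kappa ::
  "real \<Rightarrow> (int \<Rightarrow> int \<Rightarrow> 'p::euclidean_space \<Rightarrow> real^4) \<Rightarrow> int \<Rightarrow> int \<Rightarrow> 'p two_form" where
  "kappa \<beta> z i n p \<xi> \<eta> =
     1 / 2 * vwedge (ext_d (z i (n - 1))) (mat_form (K_mat \<beta>) (ext_d (z i n))) p \<xi> \<eta>"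

definition du :: "(int \<Rightarrow> int \<Rightarrow> 'p::euclidean_space \<Rightarrow> real^4) \<Rightarrow> int \<Rightarrow> int \<Rightarrow> ('p, real) one_form" where
  "du z i n = ext_d (\<lambda>p. z i n p $ 1)"

end

theory Submission
  imports Defs
begin

text \<open>
  Why the theorem is true. Fix a parameter value \<open>p\<close> and two tangent vectors \<open>\<xi>\<close>, \<open>\<eta>\<close>, and let
  \<open>x\<close> and \<open>y\<close> be the differentials of the grid functions evaluated at \<open>\<xi>\<close> and \<open>\<eta>\<close>. Every two-form
  then becomes an ordinary bilinear expression in the two real grid functions \<open>x\<close> and \<open>y\<close>, and the
  claim is an identity about them.

  Since \<open>M\<close> is skew, a one-step difference of \<open>x\<^sup>i\<^sup>-\<^sup>1 \<bullet> M y\<^sup>i - y\<^sup>i\<^sup>-\<^sup>1 \<bullet> M x\<^sup>i\<close> can be regrouped so that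
  only \<open>x\<^sup>i\<close> and \<open>y\<^sup>i\<close> stand outside the matrix, paired with the central differences of \<open>y\<close> and \<open>x\<close>
  (\<open>fwd_diff_skew_form\<close>); the same holds in space for \<open>K\<close>. Hence
  \<open>\<delta>\<^sub>t\<^sup>+ \<omega> + \<delta>\<^sub>x\<^sup>+ \<kappa> = dz \<and> (M \<delta>\<^sub>t dz + K \<delta>\<^sub>x dz)\<close>, and the bracket is the differential of
  the right-hand side of the scheme (\<open>variational_equation\<close>). All pointwise terms of that
  differential come from a symmetric Hessian and disappear in the wedge product with \<open>dz\<close>; the
  nonlocal term alone survives (\<open>d_grad_S_antisymmetrized\<close>). This is the local law.

  For the global law, sum over one period. The flux telescopes and vanishes because \<open>\<kappa>\<close> inherits the
  periodicity of \<open>z\<close>. The source term vanishes because the Fourier multiplier is real and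
  depends on a wave number only through its absolute value, so that the operator is a convolution
  with a real kernel composed of cosines; such a kernel is even, and the operator is therefore
  self-adjoint on one period (\<open>L_op_self_adjoint\<close>).
\<close>

section \<open>Symmetry of the discrete nonlocal operator\<close>

text \<open>The convolution kernel of the operator: the inverse Fourier transform of its real symbol. Only the
  cosine part appears, because \<open>L_op\<close> is the real part of the complex operator.\<close>

definition L_kernel :: "nat \<Rightarrow> real \<Rightarrow> int \<Rightarrow> real" where
  "L_kernel N l j =
     (1 / real N) * (\<Sum>k<N. 2 * pi / l * real_of_int (K_tilde N k * S_sign N k)
        * cos (2 * pi * real_of_int j * real k / real N))"

lemma L_kernel_even: "L_kernel N l (- j) = L_kernel N l j"
  by (simp add: L_kernel_def)

lemma Re_exp_diff_modes:
  "Re (exp (- 2 * of_real pi * \<i> * of_nat m * of_nat k / of_nat N)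
       * exp (2 * of_real pi * \<i> * of_int n * of_nat k / of_nat N))
     = cos (2 * pi * real_of_int (n - int m) * real k / real N)"
proof -
  have "- 2 * of_real pi * \<i> * of_nat m * of_nat k / of_nat N
        + 2 * of_real pi * \<i> * of_int n * of_nat k / of_nat N
      = \<i> * complex_of_real (2 * pi * real_of_int (n - int m) * real k / real N)"
    by (cases "N = 0") (simp_all add: field_simps)
  then show ?thesis
    by (simp only: exp_add[symmetric] cis_conv_exp[symmetric] cis.sel)
qed

text \<open>Inserting the definition of the transform into that of its inverse and exchanging the two sums
  leaves, for each pair of grid points, a sum over modes that depends only on their difference.
  In this form the operator is visibly linear, and evenness of its kernel gives self-adjointness.\<close>

lemma L_op_convolution: "L_op N l u n = (\<Sum>m<N. L_kernel N l (n - int m) * u (int m))"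
proof -
  define s where "s k = 2 * pi / l * real_of_int (K_tilde N k * S_sign N k)" for k
  define e where "e m k = exp (- 2 * of_real pi * \<i> * of_nat m * of_nat k / of_nat N)
       * exp (2 * of_real pi * \<i> * of_int n * of_nat k / of_nat N)" for m k
  have "L_cplx N l (\<lambda>m. of_real (u m)) n
      = of_real (1 / real N) * (\<Sum>k<N. \<Sum>m<N. of_real (s k * u (int m)) * e m k)"
    unfolding L_cplx_def inv_dft_def dft_def s_def e_def
    by (simp add: sum_distrib_left sum_distrib_right mult_ac)
  then have "L_op N l u n = (1 / real N) * (\<Sum>k<N. \<Sum>m<N. s k * u (int m) * Re (e m k))"
    unfolding L_op_def by (simp only: Re_complex_of_real times_complex.sel Im_complex_of_real Re_sum) simp
  also have "\<dots> = (\<Sum>m<N. L_kernel N l (n - int m) * u (int m))"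
    unfolding e_def Re_exp_diff_modes L_kernel_def s_def[symmetric]
    by (subst sum.swap) (simp add: sum_distrib_left sum_distrib_right mult_ac)
  finally show ?thesis .
qed

lemma L_op_self_adjoint:
  "(\<Sum>n<N. a (int n) * L_op N l b (int n)) = (\<Sum>n<N. b (int n) * L_op N l a (int n))"
proof -
  have "(\<Sum>n<N. a (int n) * L_op N l b (int n))
      = (\<Sum>m<N. \<Sum>n<N. L_kernel N l (int n - int m) * a (int n) * b (int m))"
    unfolding L_op_convolution by (subst sum.swap) (simp add: sum_distrib_left mult_ac)
  also have "\<dots> = (\<Sum>m<N. \<Sum>n<N. L_kernel N l (int m - int n) * a (int n) * b (int m))"
    using L_kernel_even[of N l "int _ - int _"] by simp
  also have "\<dots> = (\<Sum>m<N. b (int m) * L_op N l a (int m))"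
    unfolding L_op_convolution by (simp add: sum_distrib_left mult_ac)
  finally show ?thesis .
qed

lemma has_derivative_L_op:
  assumes "\<And>m. ((\<lambda>q. f q m) has_derivative (\<lambda>\<xi>. f' \<xi> m)) F"
  shows "((\<lambda>q. L_op N l (f q) n) has_derivative (\<lambda>\<xi>. L_op N l (f' \<xi>) n)) F"
  unfolding L_op_convolution by (intro has_derivative_sum has_derivative_mult_right assms)

section \<open>Exterior derivatives\<close>

lemma ext_d_eq: "(f has_derivative f') (at p) \<Longrightarrow> ext_d f p = f'"
  unfolding ext_d_def using frechet_derivative_at by fastforce

lemma has_derivative_ext_d:
  "f differentiable (at p) \<Longrightarrow> (f has_derivative ext_d f p) (at p)"
  by (simp add: ext_d_def[abs_def] frechet_derivative_works[symmetric])

text \<open>The scheme and the periodicity are known on \<open>U\<close> only. Openness of \<open>U\<close> is what allows these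
  identities to be differentiated.\<close>

lemma ext_d_cong_open:
  assumes "open U" "p \<in> U" "\<And>q. q \<in> U \<Longrightarrow> f q = g q"
  shows "ext_d f p = ext_d g p"
proof -
  have "(f has_derivative f') (at p) \<longleftrightarrow> (g has_derivative f') (at p)" for f'
    using has_derivative_transform_within_open[OF _ assms(1,2), of f f' UNIV g]
      has_derivative_transform_within_open[OF _ assms(1,2), of g f' UNIV f] assms(3)
    by auto
  then show ?thesis
    unfolding ext_d_def frechet_derivative_def by simp
qed

lemma ext_d_vec_nth:
  assumes "f differentiable (at p)"
  shows "ext_d (\<lambda>q. f q $ k) p = (\<lambda>\<xi>. ext_d f p \<xi> $ k)"
  by (rule ext_d_eq) (rule bounded_linear.has_derivative[OF bounded_linear_vec_nth has_derivative_ext_d[OF assms]])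

section \<open>Skew matrices and discrete two-forms\<close>

definition skew :: "real^'n^'n \<Rightarrow> bool" where
  "skew A \<longleftrightarrow> transpose A = - A"

lemma inner_skew_commute:
  assumes "skew A"
  shows "x \<bullet> (A *v y) = - (y \<bullet> (A *v x))"
proof -
  have "x \<bullet> (A *v y) = (transpose A *v x) \<bullet> y"
    by (metis dot_lmul_matrix transpose_matrix_vector)
  then show ?thesis
    using assms by (simp add: skew_def inner_commute matrix_vector_mult_def vec_eq_iff sum_negf inner_vec_def)
qed

lemma skew_M_mat: "skew M_mat"
  by (simp add: skew_def transpose_def vec_eq_iff forall_4 M_mat_def vector_4)

lemma skew_K_mat: "skew (K_mat \<beta>)"
  by (simp add: skew_def transpose_def vec_eq_iff forall_4 K_mat_def vector_4)

lemma vwedge_mat_form: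
  "vwedge a (mat_form A b) p \<xi> \<eta> = a p \<xi> \<bullet> (A *v b p \<eta>) - a p \<eta> \<bullet> (A *v b p \<xi>)"
  by (simp add: vwedge_def wedge_def mat_form_def inner_vec_def sum_subtractf)

text \<open>Both conservation forms pair a differential with its successor. In the difference of two
  neighbouring values, the term \<open>- x (k - 1) \<bullet> A y k\<close> equals \<open>y k \<bullet> A x (k - 1)\<close> by skewness; it
  combines with \<open>- y k \<bullet> A x (k + 1)\<close> into a central difference of \<open>x\<close> at \<open>k\<close>, and likewise with
  \<open>x\<close> and \<open>y\<close> exchanged. With \<open>k\<close> as time index and \<open>M\<close> this treats \<open>\<omega>\<close>, with \<open>k\<close> as space index
  and \<open>K\<close> it treats \<open>\<kappa>\<close>.\<close>

lemma fwd_diff_skew_form: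
  fixes x y :: "int \<Rightarrow> real^'n"
  assumes "skew A"
  shows "fwd_diff h (\<lambda>k. 1 / 2 * (x (k - 1) \<bullet> (A *v y k) - y (k - 1) \<bullet> (A *v x k))) k
       = x k \<bullet> (A *v ctr_diff h y k) - y k \<bullet> (A *v ctr_diff h x k)"
proof -
  have "x (k - 1) \<bullet> (A *v y k) = - (y k \<bullet> (A *v x (k - 1)))"
    and "y (k - 1) \<bullet> (A *v x k) = - (x k \<bullet> (A *v y (k - 1)))"
    by (rule inner_skew_commute[OF assms])+
  then show ?thesis
    by (cases "h = 0")
       (simp_all add: fwd_diff_def ctr_diff_def matrix_vector_mult_scaleR
         matrix_vector_mult_diff_distrib inner_diff_right field_simps)
qed

lemma sum_fwd_diff: "(\<Sum>n<N. fwd_diff h f (int n)) = (f (int N) - f 0) /\<^sub>R h"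
proof -
  have "(\<Sum>n<N. fwd_diff h f (int n)) = (\<Sum>n<N. f (int (Suc n)) - f (int n)) /\<^sub>R h"
    by (simp add: fwd_diff_def scaleR_sum_right add.commute)
  then show ?thesis
    using sum_lessThan_telescope[of "\<lambda>n. f (int n)" N] by simp
qed

section \<open>The discrete variational equation\<close>

definition d_grad_S ::
  "real \<Rightarrow> real \<Rightarrow> real \<Rightarrow> real \<Rightarrow> nat \<Rightarrow> real \<Rightarrow> (int \<Rightarrow> real^4) \<Rightarrow> (int \<Rightarrow> real^4) \<Rightarrow> int \<Rightarrow> real^4"
  where
  "d_grad_S \<alpha> \<beta> \<gamma> lam N l z x n =
     vector [- (x n $ 3) - \<gamma> * (x n $ 1) - lam * (z n $ 1) * (x n $ 1)
               + \<alpha> * L_op N l (\<lambda>m. x m $ 1) n,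
             0,
             - (x n $ 1),
             \<beta> * (x n $ 4)]"

text \<open>The derivative is taken component by component because the gradient is given as a list of real
  components.\<close>

lemma has_derivative_grad_S_nth:
  assumes "\<And>m. ((\<lambda>q. z q m) has_derivative (\<lambda>\<xi>. x \<xi> m)) (at p)"
  shows "((\<lambda>q. grad_S \<alpha> \<beta> \<gamma> lam N l (z q) n $ k)
           has_derivative (\<lambda>\<xi>. d_grad_S \<alpha> \<beta> \<gamma> lam N l (z p) (x \<xi>) n $ k)) (at p)"
proof -
  have c [derivative_intros]:
    "((\<lambda>q. z q m $ j) has_derivative (\<lambda>\<xi>. x \<xi> m $ j)) (at p)" for m j
    by (rule bounded_linear.has_derivative[OF bounded_linear_vec_nth assms])
  have L [derivative_intros]:
    "((\<lambda>q. L_op N l (\<lambda>m. z q m $ 1) n) has_derivative (\<lambda>\<xi>. L_op N l (\<lambda>m. x \<xi> m $ 1) n)) (at p)"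
    by (rule has_derivative_L_op) (rule c)
  show ?thesis
    using exhaust_4[of k] unfolding grad_S_def d_grad_S_def
    by (elim disjE; simp only: vector_4)
       (auto intro!: derivative_eq_intros simp: algebra_simps)
qed

text \<open>The scheme holds identically in the parameter on an open set, and its left-hand side is linear
  in \<open>z\<close>, so differentiation replaces \<open>z\<close> by \<open>dz\<close> there and linearises the right-hand side.\<close>

lemma variational_equation:
  fixes z :: "int \<Rightarrow> int \<Rightarrow> 'p::euclidean_space \<Rightarrow> real^4"
  assumes U: "open U" "p \<in> U"
    and diff: "\<And>j m. i - 1 \<le> j \<Longrightarrow> j \<le> i + 1 \<Longrightarrow> z j m differentiable (at p)"
    and scheme: "\<And>q. q \<in> U \<Longrightarrow> euler_box \<alpha> \<beta> \<gamma> lam N l dt (\<lambda>j m. z j m q) i n"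
  shows "M_mat *v ctr_diff dt (\<lambda>j. ext_d (z j n) p \<xi>) i
         + K_mat \<beta> *v ctr_diff (l / real N) (\<lambda>m. ext_d (z i m) p \<xi>) n
       = d_grad_S \<alpha> \<beta> \<gamma> lam N l (\<lambda>m. z i m p) (\<lambda>m. ext_d (z i m) p \<xi>) n"
proof -
  let ?lhs = "\<lambda>x. M_mat *v ctr_diff dt (\<lambda>j. x j n) i + K_mat \<beta> *v ctr_diff (l / real N) (x i) n"
  have d: "(z j m has_derivative ext_d (z j m) p) (at p)" if "i - 1 \<le> j" "j \<le> i + 1" for j m
    by (rule has_derivative_ext_d) (rule diff[OF that])
  have "((\<lambda>q. ?lhs (\<lambda>j m. z j m q)) has_derivative (\<lambda>\<xi>. ?lhs (\<lambda>j m. ext_d (z j m) p \<xi>))) (at p)"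
    unfolding ctr_diff_def
    by (intro has_derivative_add has_derivative_diff has_derivative_scaleR_right d
        bounded_linear.has_derivative[OF matrix_vector_mul_bounded_linear]) auto
  then have "ext_d (\<lambda>q. ?lhs (\<lambda>j m. z j m q) $ k) p = (\<lambda>\<xi>. ?lhs (\<lambda>j m. ext_d (z j m) p \<xi>) $ k)" for k
    by (intro ext_d_eq bounded_linear.has_derivative[OF bounded_linear_vec_nth])
  moreover have "ext_d (\<lambda>q. grad_S \<alpha> \<beta> \<gamma> lam N l (\<lambda>m. z i m q) n $ k) p
      = (\<lambda>\<xi>. d_grad_S \<alpha> \<beta> \<gamma> lam N l (\<lambda>m. z i m p) (\<lambda>m. ext_d (z i m) p \<xi>) n $ k)" for k
    by (intro ext_d_eq has_derivative_grad_S_nth d) auto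
  moreover have "ext_d (\<lambda>q. ?lhs (\<lambda>j m. z j m q) $ k) p
      = ext_d (\<lambda>q. grad_S \<alpha> \<beta> \<gamma> lam N l (\<lambda>m. z i m q) n $ k) p" for k
    by (rule ext_d_cong_open[OF U]) (use scheme in \<open>simp add: euler_box_def\<close>)
  ultimately show ?thesis
    by (auto simp: vec_eq_iff fun_eq_iff)
qed

text \<open>The local part of the right-hand side is the gradient of a function of the four components of
  \<open>z\<close>, so its linearisation is a symmetric matrix: the diagonal terms \<open>\<gamma>\<close>, \<open>lam\<close>, \<open>\<beta>\<close> and the
  symmetric coupling of \<open>u\<close> and \<open>w\<close> cancel under antisymmetrisation. The nonlocal term is symmetric
  only after summation over the grid, hence it remains pointwise.\<close>

lemma d_grad_S_antisymmetrized:
  "x n \<bullet> d_grad_S \<alpha> \<beta> \<gamma> lam N l z y n - y n \<bullet> d_grad_S \<alpha> \<beta> \<gamma> lam N l z x n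
   = \<alpha> * (x n $ 1 * L_op N l (\<lambda>m. y m $ 1) n - y n $ 1 * L_op N l (\<lambda>m. x m $ 1) n)"
  by (simp add: inner_vec_def sum_4 d_grad_S_def vector_4 algebra_simps)

section \<open>The conservation laws\<close>

theorem theorem1:
  fixes \<alpha> \<beta> \<gamma> lam l dt :: real
    and N :: nat
    and T :: int
    and U :: "'p::euclidean_space set"
    and z :: "int \<Rightarrow> int \<Rightarrow> 'p \<Rightarrow> real^4"
  assumes "l > 0" and "dt > 0" and "N > 0"
    and "open U"
    and diff: "\<And>i n p. 0 \<le> i \<Longrightarrow> i \<le> T \<Longrightarrow> p \<in> U \<Longrightarrow> z i n differentiable (at p)"
    and periodic: "\<And>i n p. 0 \<le> i \<Longrightarrow> i \<le> T \<Longrightarrow> p \<in> U \<Longrightarrow> z i (n + int N) p = z i n p"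
    and scheme: "\<And>i n p. 0 < i \<Longrightarrow> i < T \<Longrightarrow> p \<in> U \<Longrightarrow>
      euler_box \<alpha> \<beta> \<gamma> lam N l dt (\<lambda>j m. z j m p) i n"
  shows "\<forall>i p \<xi> \<eta>. 0 < i \<and> i < T \<and> p \<in> U \<longrightarrow>
      (\<forall>n. fwd_diff dt (\<lambda>j. omega z j n p \<xi> \<eta>) i
             + fwd_diff (l / real N) (\<lambda>m. kappa \<beta> z i m p \<xi> \<eta>) n
           = \<alpha> * wedge (du z i n) (L_form N l (\<lambda>m. du z i m) n) p \<xi> \<eta>)
      \<and> fwd_diff dt (\<lambda>j. \<Sum>n = 0..<N. omega z j (int n) p \<xi> \<eta>) i = 0"
proof (intro allI impI)
  fix i :: int and p \<xi> \<eta> :: 'p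
  assume "0 < i \<and> i < T \<and> p \<in> U"
  then have i: "0 < i" "i < T" and p: "p \<in> U"
    by auto
  \<comment> \<open>Evaluating the one-forms at fixed tangent vectors turns the exterior calculus into algebra.\<close>
  define x where "x j n = ext_d (z j n) p \<xi>" for j n
  define y where "y j n = ext_d (z j n) p \<eta>" for j n
  have diff_p: "z j m differentiable (at p)" if "i - 1 \<le> j" "j \<le> i + 1" for j m
    using diff[of j p m] that i p by auto
  have source: "wedge (du z i n) (L_form N l (\<lambda>m. du z i m) n) p \<xi> \<eta>
      = x i n $ 1 * L_op N l (\<lambda>m. y i m $ 1) n - y i n $ 1 * L_op N l (\<lambda>m. x i m $ 1) n" for n
    using diff_p[of i] by (simp add: wedge_def L_form_def du_def ext_d_vec_nth x_def y_def)
  have time: "fwd_diff dt (\<lambda>j. omega z j n p \<xi> \<eta>) i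
      = x i n \<bullet> (M_mat *v ctr_diff dt (\<lambda>j. y j n) i)
        - y i n \<bullet> (M_mat *v ctr_diff dt (\<lambda>j. x j n) i)" for n
    unfolding omega_def vwedge_mat_form x_def[symmetric] y_def[symmetric]
    by (rule fwd_diff_skew_form[OF skew_M_mat])
  have space: "fwd_diff (l / real N) (\<lambda>m. kappa \<beta> z i m p \<xi> \<eta>) n
      = x i n \<bullet> (K_mat \<beta> *v ctr_diff (l / real N) (y i) n)
        - y i n \<bullet> (K_mat \<beta> *v ctr_diff (l / real N) (x i) n)" for n
    unfolding kappa_def vwedge_mat_form x_def[symmetric] y_def[symmetric]
    by (rule fwd_diff_skew_form[OF skew_K_mat])
  have vx: "M_mat *v ctr_diff dt (\<lambda>j. x j n) i + K_mat \<beta> *v ctr_diff (l / real N) (x i) n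
      = d_grad_S \<alpha> \<beta> \<gamma> lam N l (\<lambda>m. z i m p) (x i) n" for n
    unfolding x_def by (rule variational_equation[OF \<open>open U\<close> p diff_p scheme[OF i]])
  have vy: "M_mat *v ctr_diff dt (\<lambda>j. y j n) i + K_mat \<beta> *v ctr_diff (l / real N) (y i) n
      = d_grad_S \<alpha> \<beta> \<gamma> lam N l (\<lambda>m. z i m p) (y i) n" for n
    unfolding y_def by (rule variational_equation[OF \<open>open U\<close> p diff_p scheme[OF i]])
  have local_law: "fwd_diff dt (\<lambda>j. omega z j n p \<xi> \<eta>) i
        + fwd_diff (l / real N) (\<lambda>m. kappa \<beta> z i m p \<xi> \<eta>) n
      = \<alpha> * wedge (du z i n) (L_form N l (\<lambda>m. du z i m) n) p \<xi> \<eta>" for n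
    using d_grad_S_antisymmetrized[of "x i" n \<alpha> \<beta> \<gamma> lam N l "\<lambda>m. z i m p" "y i"]
    unfolding source time space vx[symmetric] vy[symmetric]
    by (simp add: inner_add_right)
  have ext_d_periodic: "ext_d (z i (m + int N)) p = ext_d (z i m) p" for m
    by (rule ext_d_cong_open[OF \<open>open U\<close> p]) (use periodic i in simp)
  \<comment> \<open>\<open>kappa\<close> at a grid point also involves its left neighbour, so periodicity is used at \<open>0\<close> and \<open>- 1\<close>.\<close>
  have "kappa \<beta> z i (int N) p \<xi> \<eta> = kappa \<beta> z i 0 p \<xi> \<eta>"
    using ext_d_periodic[of 0] ext_d_periodic[of "- 1"]
    by (simp add: kappa_def vwedge_mat_form)
  then have flux: "(\<Sum>n<N. fwd_diff (l / real N) (\<lambda>m. kappa \<beta> z i m p \<xi> \<eta>) (int n)) = 0"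
    by (simp add: sum_fwd_diff)
  have "(\<Sum>n<N. wedge (du z i (int n)) (L_form N l (\<lambda>m. du z i m) (int n)) p \<xi> \<eta>) = 0"
    unfolding source sum_subtractf
    using L_op_self_adjoint[of "\<lambda>m. x i m $ 1" N l "\<lambda>m. y i m $ 1"] by simp
  then have "(\<Sum>n<N. fwd_diff dt (\<lambda>j. omega z j (int n) p \<xi> \<eta>) i
      + fwd_diff (l / real N) (\<lambda>m. kappa \<beta> z i m p \<xi> \<eta>) (int n)) = 0"
    unfolding local_law by (simp add: sum_distrib_left[symmetric])
  then have "(\<Sum>n<N. fwd_diff dt (\<lambda>j. omega z j (int n) p \<xi> \<eta>) i) = 0"
    by (simp add: sum.distrib flux)
  then have "fwd_diff dt (\<lambda>j. \<Sum>n = 0..<N. omega z j (int n) p \<xi> \<eta>) i = 0"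
    unfolding fwd_diff_def
    by (simp add: sum_distrib_left[symmetric] sum_subtractf atLeast0LessThan)
  with local_law show "(\<forall>n. fwd_diff dt (\<lambda>j. omega z j n p \<xi> \<eta>) i
             + fwd_diff (l / real N) (\<lambda>m. kappa \<beta> z i m p \<xi> \<eta>) n
           = \<alpha> * wedge (du z i n) (L_form N l (\<lambda>m. du z i m) n) p \<xi> \<eta>)
      \<and> fwd_diff dt (\<lambda>j. \<Sum>n = 0..<N. omega z j (int n) p \<xi> \<eta>) i = 0"
    by blast
qed

end
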